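(* For every $n\ge1$ let $\theta_{0,n}\in\Theta_n$ and let $X^n\sim P_{\theta_{0,n},n}$ (planted bi-section model with edge probabilities $p_n,q_n\in(0,1)$), and equip every $\Theta_n$ with its uniform prior. Suppose that the posterior recovers communities almost-exactly with error rate $(k_n)$, where $k_n\ge1$ are integers with $k_n=o(n)$: $$\Pi\bigl(\{\theta\in\Theta_n:k(\theta,\theta_{0,n})\le k_n\}\bigm|X^n\bigr)\to1\quad\text{in }P_{\theta_{0,n},n}\text{-probability}.$$ Let $(c_n)$, $c_n\in[0,1]$, satisfy $\liminf_nc_n>0$ and let $(D_n)$ be a sequence of ($P_n^\Pi$-almost-sure) credible sets of levels $c_n$. Then the $k_n$-enlargements $$C_n(X^n)=\{\theta\in\Theta_n:\exists\,\eta\in D_n(X^n),\ k(\eta,\theta)\le k_n\}$$ satisfy $P_{\theta_{0,n},n}(\theta_{0,n}\in C_n(X^n))\to1$ as $n\to\infty$, i.e. they form a consistent sequence of confidence sets. If the sets $D_n$ have minimal diameters (among level-$c_n$ credible sets), then $$\mathrm{diam}_n(D_n(X^n))\le2k_n,\qquad \mathrm{diam}_n(C_n(X^n))\le4k_n,$$ with $P_{\theta_{0,n},n}$-probability tending to one.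
   Context: Planted bi-section model. For $n\ge1$, $\Theta_n'$ is the set of $\theta'\in\{0,1\}^{2n}$ with exactly $n$ zeros and $n$ ones. Let $\neg\theta'$ denote component-wise negation, let $\sim_n$ be the equivalence relation identifying $\theta'$ with $\neg\theta'$, and let $\Theta_n=\Theta_n'/\sim_n$. Given $p_n,q_n\in(0,1)$ and $\theta\in\Theta_n$ with representative $\theta'$, $P_{\theta,n}$ is the law of the random simple undirected graph $X^n$ (no loops) on vertices $\{1,\dots,2n\}$, with adjacency indicators $X_{ij}$ ($i<j$), whose edges occur independently with $P_{\theta,n}(X_{ij}=1)=p_n$ if $\theta'_i=\theta'_j$ and $=q_n$ if $\theta'_i\ne\theta'_j$ (independent of the representative). $\mathscr X_n$ is the finite set of such graphs. Let $p_{\theta,n}(x^n)=P_{\theta,n}(X^n=x^n)$. With the uniform prior on $\Theta_n$, the posterior is, for $A\subset\Theta_n$, $$\Pi(A|X^n)=\sum_{\theta\in A}p_{\theta,n}(X^n)\Big/\sum_{\theta\in\Theta_n}p_{\theta,n}(X^n),$$ and $P_n^{\Pi}=|\Theta_n|^{-1}\sum_{\theta\in\Theta_n}P_{\theta,n}$ is the prior predictive distribution. A sequence of credible sets of levels $c_n$ is a sequence of set-valued maps $D_n$ from $\mathscr X_n$ to subsets of $\Theta_n$ with $\Pi(D_n(X^n)|X^n)\ge c_n$, $P_n^\Pi$-almost-surely. Metric on $\Theta_n$: with $Z(\theta')=\{i:\theta'_i=0\}$, $k'(\theta_1',\theta_2')=|Z(\theta_1')\setminus Z(\theta_2')|$,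 and $k(\theta_1,\theta_2)=\min\{k'(\theta_1',\theta_2'),k'(\theta_1',\neg\theta_2')\}$ for representatives $\theta_i'$ of $\theta_i$. For $C\subset\Theta_n$, $\mathrm{diam}_n(C)=\max\{k(\theta,\eta):\theta,\eta\in C\}$.
   Formalization: The diameter bounds are proved under the additional assumption limsup c_n < 1; without it they fail, e.g. for c_n = 1, where the only credible set is all of Θ_n. The coverage claim is as stated. *)

theory Defs
  imports "HOL-Probability.Probability" "HOL-Library.Landau_Symbols"
begin

section \<open>Community assignments\<close>

text \<open>Elements of \<open>{0,1}\<^sup>2\<^sup>n\<close> are the extensional functions on \<open>{1..2 * n}\<close>
  (with value \<^const>\<open>undefined\<close> elsewhere), so that equality is equality of vectors.\<close>

definition Theta' :: "nat \<Rightarrow> (nat \<Rightarrow> nat) set" where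
  "Theta' n = {t \<in> {1..2 * n} \<rightarrow>\<^sub>E {0, 1}.
     card {i \<in> {1..2 * n}. t i = 0} = n \<and> card {i \<in> {1..2 * n}. t i = 1} = n}"

definition neg :: "nat \<Rightarrow> (nat \<Rightarrow> nat) \<Rightarrow> (nat \<Rightarrow> nat)" where
  "neg n t = restrict (\<lambda>i. 1 - t i) {1..2 * n}"

definition neg_rel :: "nat \<Rightarrow> ((nat \<Rightarrow> nat) \<times> (nat \<Rightarrow> nat)) set" where
  "neg_rel n = {(s, t). s \<in> Theta' n \<and> t \<in> Theta' n \<and> (t = s \<or> t = neg n s)}"

definition Theta :: "nat \<Rightarrow> (nat \<Rightarrow> nat) set set" where
  "Theta n = Theta' n // neg_rel n"

text \<open>Functions on \<open>Theta n\<close> are defined through a chosen representative; the choice is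
  immaterial by the lemmas \<open>graph_law_rep\<close> and \<open>kdist_rep\<close> below.\<close>

definition rep :: "(nat \<Rightarrow> nat) set \<Rightarrow> (nat \<Rightarrow> nat)" where
  "rep \<theta> = (SOME t. t \<in> \<theta>)"

definition Z :: "nat \<Rightarrow> (nat \<Rightarrow> nat) \<Rightarrow> nat set" where
  "Z n t = {i \<in> {1..2 * n}. t i = 0}"

definition kdist' :: "nat \<Rightarrow> (nat \<Rightarrow> nat) \<Rightarrow> (nat \<Rightarrow> nat) \<Rightarrow> nat" where
  "kdist' n s t = card (Z n s - Z n t)"

definition kdist :: "nat \<Rightarrow> (nat \<Rightarrow> nat) set \<Rightarrow> (nat \<Rightarrow> nat) set \<Rightarrow> nat" where
  "kdist n \<theta> \<eta> = min (kdist' n (rep \<theta>) (rep \<eta>)) (kdist' n (rep \<theta>) (neg n (rep \<eta>)))"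

text \<open>The maximum is only meaningful for nonempty sets; the empty set gets diameter 0.\<close>

definition kdiam :: "nat \<Rightarrow> (nat \<Rightarrow> nat) set set \<Rightarrow> nat" where
  "kdiam n C = (if C = {} then 0 else Max {kdist n \<theta> \<eta> | \<theta> \<eta>. \<theta> \<in> C \<and> \<eta> \<in> C})"

section \<open>The planted bi-section model\<close>

text \<open>A simple graph on the vertex set \<open>{1..2 * n}\<close> is represented by its set of
  two-element edges.\<close>

definition vertex_pairs :: "nat \<Rightarrow> (nat \<times> nat) set" where
  "vertex_pairs n = {(i, j). 1 \<le> i \<and> i < j \<and> j \<le> 2 * n}"

definition graph_of :: "nat \<Rightarrow> (nat \<times> nat \<Rightarrow> bool) \<Rightarrow> nat set set" where
  "graph_of n X = {{i, j} | i j. (i, j) \<in> vertex_pairs n \<and> X (i, j)}"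

definition graphs :: "nat \<Rightarrow> nat set set set" where
  "graphs n = Pow {{i, j} | i j. (i, j) \<in> vertex_pairs n}"

definition graph_law' :: "nat \<Rightarrow> real \<Rightarrow> real \<Rightarrow> (nat \<Rightarrow> nat) \<Rightarrow> nat set set pmf" where
  "graph_law' n p q t = map_pmf (graph_of n)
     (Pi_pmf (vertex_pairs n) False (\<lambda>(i, j). bernoulli_pmf (if t i = t j then p else q)))"

definition graph_law :: "nat \<Rightarrow> real \<Rightarrow> real \<Rightarrow> (nat \<Rightarrow> nat) set \<Rightarrow> nat set set pmf" where
  "graph_law n p q \<theta> = graph_law' n p q (rep \<theta>)"

section \<open>Posterior and credible sets for the uniform prior\<close>

definition posterior ::
  "nat \<Rightarrow> real \<Rightarrow> real \<Rightarrow> (nat \<Rightarrow> nat) set set \<Rightarrow> nat set set \<Rightarrow> real" where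
  "posterior n p q A x =
     (\<Sum>\<theta>\<in>A. pmf (graph_law n p q \<theta>) x) / (\<Sum>\<theta>\<in>Theta n. pmf (graph_law n p q \<theta>) x)"

definition prior_predictive :: "nat \<Rightarrow> real \<Rightarrow> real \<Rightarrow> nat set set pmf" where
  "prior_predictive n p q = pmf_of_set (Theta n) \<bind> graph_law n p q"

definition credible ::
  "nat \<Rightarrow> real \<Rightarrow> real \<Rightarrow> real \<Rightarrow> (nat set set \<Rightarrow> (nat \<Rightarrow> nat) set set) \<Rightarrow> bool" where
  "credible n p q c D \<longleftrightarrow>
     D \<in> graphs n \<rightarrow> Pow (Theta n) \<and>
     (AE x in measure_pmf (prior_predictive n p q). posterior n p q (D x) x \<ge> c)"

text \<open>Pitfall: for \<open>p\<close>, \<open>q\<close> in the open unit interval every posterior mass is positive, so at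
  level \<open>c = 1\<close> the only credible set is \<open>Theta n\<close> itself, which then trivially has minimal
  diameter. Diameter bounds therefore require levels bounded away from 1.\<close>

definition minimal_diameter ::
  "nat \<Rightarrow> real \<Rightarrow> real \<Rightarrow> real \<Rightarrow> (nat set set \<Rightarrow> (nat \<Rightarrow> nat) set set) \<Rightarrow> bool" where
  "minimal_diameter n p q c D \<longleftrightarrow>
     (\<forall>E. credible n p q c E \<longrightarrow>
        (AE x in measure_pmf (prior_predictive n p q). kdiam n (D x) \<le> kdiam n (E x)))"

definition enlarge :: "nat \<Rightarrow> nat \<Rightarrow> (nat \<Rightarrow> nat) set set \<Rightarrow> (nat \<Rightarrow> nat) set set" where
  "enlarge n k D = {\<theta> \<in> Theta n. \<exists>\<eta>\<in>D. kdist n \<eta> \<theta> \<le> k}"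

definition tends_in_prob :: "(nat \<Rightarrow> 'a pmf) \<Rightarrow> (nat \<Rightarrow> 'a \<Rightarrow> real) \<Rightarrow> real \<Rightarrow> bool" where
  "tends_in_prob P Y l \<longleftrightarrow>
     (\<forall>\<epsilon>>0. (\<lambda>n. measure_pmf.prob (P n) {x. \<bar>Y n x - l\<bar> > \<epsilon>}) \<longlonglongrightarrow> 0)"

section \<open>Well-definedness\<close>

lemma finite_Theta': "finite (Theta' n)"
  unfolding Theta'_def
  by (rule finite_subset[of _ "{1..2 * n} \<rightarrow>\<^sub>E {0, 1}"]) (auto intro: finite_PiE)

lemma Theta'_bound: "t \<in> Theta' n \<Longrightarrow> i \<in> {1..2 * n} \<Longrightarrow> t i = 0 \<or> t i = 1"
  by (auto simp: Theta'_def PiE_def Pi_def)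

lemma neg_apply: "i \<in> {1..2 * n} \<Longrightarrow> neg n t i = 1 - t i"
  by (simp add: neg_def)

lemma neg_neg:
  assumes "t \<in> Theta' n"
  shows "neg n (neg n t) = t"
proof
  fix i
  show "neg n (neg n t) i = t i"
  proof (cases "i \<in> {1..2 * n}")
    case True
    with Theta'_bound[OF assms True] show ?thesis by (auto simp: neg_apply)
  next
    case False
    with assms show ?thesis by (auto simp: neg_def Theta'_def PiE_def extensional_def)
  qed
qed

lemma neg_Theta':
  assumes "t \<in> Theta' n"
  shows "neg n t \<in> Theta' n"
proof -
  have "{i \<in> {1..2 * n}. neg n t i = 0} = {i \<in> {1..2 * n}. t i = 1}"
    using Theta'_bound[OF assms] by (fastforce simp: neg_apply)
  moreover have "{i \<in> {1..2 * n}. neg n t i = 1} = {i \<in> {1..2 * n}. t i = 0}"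
    using Theta'_bound[OF assms] by (fastforce simp: neg_apply)
  moreover have "neg n t \<in> {1..2 * n} \<rightarrow>\<^sub>E {0, 1}"
    using Theta'_bound[OF assms] by (fastforce simp: neg_def)
  ultimately show ?thesis using assms by (simp add: Theta'_def)
qed

lemma equiv_neg_rel: "equiv (Theta' n) (neg_rel n)"
  unfolding equiv_def refl_on_def sym_def trans_def neg_rel_def
  by (auto simp: neg_neg)

lemma neg_rel_class: "t \<in> Theta' n \<Longrightarrow> neg_rel n `` {t} = {t, neg n t}"
  by (auto simp: neg_rel_def neg_Theta')

lemma Theta_cases:
  assumes "\<theta> \<in> Theta n" "t \<in> \<theta>"
  shows "t \<in> Theta' n" "rep \<theta> = t \<or> rep \<theta> = neg n t"
proof -
  obtain s where s: "s \<in> Theta' n" "\<theta> = {s, neg n s}"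
    using assms(1) neg_rel_class unfolding Theta_def by (metis quotientE)
  show "t \<in> Theta' n" using s assms(2) neg_Theta' by auto
  have "rep \<theta> \<in> \<theta>" using assms(2) unfolding rep_def by (rule someI[of "\<lambda>u. u \<in> \<theta>"])
  then show "rep \<theta> = t \<or> rep \<theta> = neg n t"
    using s assms(2) neg_neg by auto
qed

lemma finite_vertex_pairs: "finite (vertex_pairs n)"
  by (rule finite_subset[of _ "{1..2 * n} \<times> {1..2 * n}"]) (auto simp: vertex_pairs_def)

lemma graph_law'_neg:
  assumes "t \<in> Theta' n"
  shows "graph_law' n p q (neg n t) = graph_law' n p q t"
proof -
  have eq: "neg n t i = neg n t j \<longleftrightarrow> t i = t j" if "(i, j) \<in> vertex_pairs n" for i j
    using that Theta'_bound[OF assms, of i] Theta'_bound[OF assms, of j]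
    by (auto simp: vertex_pairs_def neg_apply)
  have "Pi_pmf (vertex_pairs n) False
          (\<lambda>(i, j). bernoulli_pmf (if neg n t i = neg n t j then p else q)) =
        Pi_pmf (vertex_pairs n) False (\<lambda>(i, j). bernoulli_pmf (if t i = t j then p else q))"
    by (rule Pi_pmf_cong) (auto simp: eq)
  then show ?thesis by (simp add: graph_law'_def)
qed

lemma graph_law_rep:
  assumes "\<theta> \<in> Theta n" "t \<in> \<theta>"
  shows "graph_law n p q \<theta> = graph_law' n p q t"
  using Theta_cases[OF assms] graph_law'_neg by (auto simp: graph_law_def)

lemma Z_neg: "t \<in> Theta' n \<Longrightarrow> Z n (neg n t) = {1..2 * n} - Z n t"
  using Theta'_bound by (fastforce simp: Z_def neg_apply)

lemma card_Z: "t \<in> Theta' n \<Longrightarrow> card (Z n t) = n"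
  by (simp add: Z_def Theta'_def)

lemma Z_subset: "Z n t \<subseteq> {1..2 * n}"
  by (auto simp: Z_def)

lemma kdist'_sym:
  assumes "s \<in> Theta' n" "t \<in> Theta' n"
  shows "kdist' n s t = kdist' n t s"
proof -
  have "finite (Z n s)" "finite (Z n t)" using Z_subset finite_subset by blast+
  then show ?thesis
    using assms card_Z unfolding kdist'_def
    by (metis card_Diff_subset_Int finite_Int inf_commute)
qed

lemma kdist'_neg_neg:
  assumes "s \<in> Theta' n" "t \<in> Theta' n"
  shows "kdist' n (neg n s) (neg n t) = kdist' n s t"
proof -
  have "Z n (neg n s) - Z n (neg n t) = Z n t - Z n s"
    using assms Z_subset[of n t] by (auto simp: Z_neg)
  then show ?thesis using kdist'_sym[OF assms] by (simp add: kdist'_def)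
qed

lemma kdist_rep:
  assumes "\<theta> \<in> Theta n" "s \<in> \<theta>" "\<eta> \<in> Theta n" "t \<in> \<eta>"
  shows "kdist n \<theta> \<eta> = min (kdist' n s t) (kdist' n s (neg n t))"
proof -
  note s = Theta_cases[OF assms(1,2)] and t = Theta_cases[OF assms(3,4)]
  have "kdist' n (neg n s) t = kdist' n s (neg n t)"
    using kdist'_neg_neg[of s n "neg n t"] s(1) t(1) by (simp add: neg_neg neg_Theta')
  moreover have "kdist' n (neg n s) (neg n t) = kdist' n s t"
    using kdist'_neg_neg s(1) t(1) by simp
  ultimately show ?thesis
    using s t by (auto simp: kdist_def neg_neg min.commute)
qed

lemma finite_Theta: "finite (Theta n)"
  unfolding Theta_def
  by (rule finite_quotient[OF finite_Theta']) (auto simp: neg_rel_def)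

lemma Theta'_nonempty: "Theta' n \<noteq> {}"
proof -
  define t where "t = restrict (\<lambda>i. if i \<le> n then 0 else 1 :: nat) {1..2 * n}"
  have "{i \<in> {1..2 * n}. t i = 0} = {1..n}" "{i \<in> {1..2 * n}. t i = 1} = {n<..2 * n}"
    by (auto simp: t_def split: if_splits)
  moreover have "t \<in> {1..2 * n} \<rightarrow>\<^sub>E {0, 1}" by (auto simp: t_def)
  ultimately have "t \<in> Theta' n" by (simp add: Theta'_def)
  then show ?thesis by blast
qed

lemma Theta_nonempty: "Theta n \<noteq> {}"
  using Theta'_nonempty by (auto simp: Theta_def quotient_def)

lemma pmf_prior_predictive:
  "pmf (prior_predictive n p q) x = (\<Sum>\<theta>\<in>Theta n. pmf (graph_law n p q \<theta>) x) / card (Theta n)"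
  unfolding prior_predictive_def
  by (rule pmf_bind_pmf_of_set[OF Theta_nonempty finite_Theta])

lemma set_pmf_graph_law: "set_pmf (graph_law n p q \<theta>) \<subseteq> graphs n"
  by (auto simp: graph_law_def graph_law'_def graph_of_def graphs_def)

end

theory Submission
  imports Defs
begin

text \<open>
  The limits reduce to two facts about a single sample size \<open>n\<close>. Let \<open>B\<close> be the ball of
  radius \<open>k\<close> around the true class \<open>\<theta>\<^sub>0\<close>.

  Two sets whose posterior masses add up to more than one must meet. On the event that \<open>B\<close> has
  posterior mass at least \<open>1 - \<epsilon>\<close>, with \<open>\<epsilon> < c\<close>, a credible set of level \<open>c\<close> therefore contains
  some \<open>\<eta>\<close> within distance \<open>k\<close> of \<open>\<theta>\<^sub>0\<close>, which says that its \<open>k\<close>-enlargement contains \<open>\<theta>\<^sub>0\<close>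
  (\<open>credible_enlarge_covers\<close>). One \<open>\<epsilon> > 0\<close> serves all
  large \<open>n\<close> because \<open>liminf c > 0\<close>.

  For the diameters, \<open>B\<close> itself competes: the map that returns \<open>B\<close> where \<open>B\<close> has posterior
  mass at least \<open>c\<close>, and the whole of \<open>Theta n\<close> elsewhere, is credible of level \<open>c\<close>. On the event
  that \<open>B\<close> has posterior mass at least \<open>1 - \<epsilon>\<close>, with \<open>c \<le> 1 - \<epsilon>\<close>, a set of minimal diameter is
  thus at most as wide as \<open>B\<close>, hence at most \<open>2 * k\<close>
  (\<open>minimal_diameter_le_ball\<close>), and enlarging a set by \<open>k\<close> adds at most \<open>2 * k\<close> (\<open>kdiam_enlarge\<close>). One \<open>\<epsilon> > 0\<close> serves all
  large \<open>n\<close> because \<open>limsup c < 1\<close>.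

  Almost-sure statements under the prior predictive distribution carry over to the law of
  \<open>\<theta>\<^sub>0\<close>, since that law is one of the components of the mixture. In both cases the event has probability
  tending to one by almost-exact recovery (\<open>tends_in_prob_eventually\<close>).
\<close>

section \<open>The metric on community assignments\<close>

lemma rep_in:
  assumes "\<theta> \<in> Theta n"
  shows "rep \<theta> \<in> \<theta>"
proof -
  obtain s where "s \<in> \<theta>"
    using assms neg_rel_class unfolding Theta_def by (metis quotientE insertI1)
  then show ?thesis unfolding rep_def by (rule someI[of "\<lambda>u. u \<in> \<theta>"])
qed

lemma neg_in_class:
  assumes "\<theta> \<in> Theta n" "t \<in> \<theta>"
  shows "neg n t \<in> \<theta>"
proof -
  obtain s where "s \<in> Theta' n" "\<theta> = {s, neg n s}"
    using assms(1) neg_rel_class unfolding Theta_def by (metis quotientE)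
  then show ?thesis using assms(2) by (auto simp: neg_neg)
qed

lemma kdist_le_kdist':
  assumes "\<theta> \<in> Theta n" "s \<in> \<theta>" "\<eta> \<in> Theta n" "t \<in> \<eta>"
  shows "kdist n \<theta> \<eta> \<le> kdist' n s t"
  using kdist_rep[OF assms] by simp

text \<open>Classes have just two members, exchanged by negation, so one of the two arguments of the
  minimum can be kept fixed. Choosing representatives one after the other in this way reduces
  statements about \<open>kdist\<close> to statements about \<open>kdist'\<close>.\<close>

lemma kdist_attained:
  assumes "\<theta> \<in> Theta n" "s \<in> \<theta>" "\<eta> \<in> Theta n"
  obtains t where "t \<in> \<eta>" "kdist n \<theta> \<eta> = kdist' n s t"
proof -
  have r: "rep \<eta> \<in> \<eta>" "neg n (rep \<eta>) \<in> \<eta>"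
    using rep_in[OF assms(3)] neg_in_class[OF assms(3)] by auto
  have "kdist n \<theta> \<eta> = kdist' n s (rep \<eta>) \<or> kdist n \<theta> \<eta> = kdist' n s (neg n (rep \<eta>))"
    using kdist_rep[OF assms r(1)] by (simp add: min_def)
  then show thesis using that r by blast
qed

lemma kdist_sym:
  assumes "\<theta> \<in> Theta n" "\<eta> \<in> Theta n"
  shows "kdist n \<theta> \<eta> = kdist n \<eta> \<theta>"
proof -
  have "kdist n b a \<le> kdist n a b" if a: "a \<in> Theta n" and b: "b \<in> Theta n" for a b
  proof -
    obtain t where t: "t \<in> b" "kdist n a b = kdist' n (rep a) t"
      using kdist_attained[OF a rep_in[OF a] b] .
    have "kdist' n (rep a) t = kdist' n t (rep a)"
      using kdist'_sym Theta_cases(1)[OF a rep_in[OF a]] Theta_cases(1)[OF b t(1)] by blast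
    then show ?thesis using kdist_le_kdist'[OF b t(1) a rep_in[OF a]] t(2) by simp
  qed
  then show ?thesis using assms by (meson le_antisym)
qed

lemma kdist'_triangle: "kdist' n s u \<le> kdist' n s t + kdist' n t u"
proof -
  have fin: "finite (Z n r)" for r using Z_subset finite_subset by blast
  have "card (Z n s - Z n u) \<le> card ((Z n s - Z n t) \<union> (Z n t - Z n u))"
    using fin by (intro card_mono) auto
  also have "\<dots> \<le> card (Z n s - Z n t) + card (Z n t - Z n u)"
    by (rule card_Un_le)
  finally show ?thesis by (simp add: kdist'_def)
qed

lemma kdist_triangle:
  assumes \<theta>: "\<theta> \<in> Theta n" and \<eta>: "\<eta> \<in> Theta n" and \<zeta>: "\<zeta> \<in> Theta n"
  shows "kdist n \<theta> \<zeta> \<le> kdist n \<theta> \<eta> + kdist n \<eta> \<zeta>"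
proof -
  note s = rep_in[OF \<theta>]
  obtain t where t: "t \<in> \<eta>" "kdist n \<theta> \<eta> = kdist' n (rep \<theta>) t"
    using kdist_attained[OF \<theta> s \<eta>] .
  obtain u where u: "u \<in> \<zeta>" "kdist n \<eta> \<zeta> = kdist' n t u"
    using kdist_attained[OF \<eta> t(1) \<zeta>] .
  have "kdist n \<theta> \<zeta> \<le> kdist' n (rep \<theta>) u"
    by (rule kdist_le_kdist'[OF \<theta> s \<zeta> u(1)])
  also have "\<dots> \<le> kdist n \<theta> \<eta> + kdist n \<eta> \<zeta>"
    unfolding t(2) u(2) by (rule kdist'_triangle)
  finally show ?thesis .
qed

section \<open>Diameters of balls and enlargements\<close>

lemma finite_kdist_values:
  assumes "C \<subseteq> Theta n"
  shows "finite {kdist n \<theta> \<eta> | \<theta> \<eta>. \<theta> \<in> C \<and> \<eta> \<in> C}"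
proof -
  have "{kdist n \<theta> \<eta> | \<theta> \<eta>. \<theta> \<in> C \<and> \<eta> \<in> C} = (\<lambda>(\<theta>, \<eta>). kdist n \<theta> \<eta>) ` (C \<times> C)"
    by auto
  then show ?thesis using finite_subset[OF assms finite_Theta] by simp
qed

lemma kdiam_le:
  assumes "C \<subseteq> Theta n" "\<And>\<theta> \<eta>. \<theta> \<in> C \<Longrightarrow> \<eta> \<in> C \<Longrightarrow> kdist n \<theta> \<eta> \<le> m"
  shows "kdiam n C \<le> m"
proof (cases "C = {}")
  case False
  then have "{kdist n \<theta> \<eta> | \<theta> \<eta>. \<theta> \<in> C \<and> \<eta> \<in> C} \<noteq> {}" by blast
  then have "Max {kdist n \<theta> \<eta> | \<theta> \<eta>. \<theta> \<in> C \<and> \<eta> \<in> C} \<le> m"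
    using finite_kdist_values[OF assms(1)] assms(2) by (subst Max_le_iff) auto
  then show ?thesis using False by (simp add: kdiam_def)
qed (simp add: kdiam_def)

lemma kdist_le_kdiam:
  assumes "C \<subseteq> Theta n" "\<theta> \<in> C" "\<eta> \<in> C"
  shows "kdist n \<theta> \<eta> \<le> kdiam n C"
proof -
  have "kdist n \<theta> \<eta> \<le> Max {kdist n \<theta> \<eta> | \<theta> \<eta>. \<theta> \<in> C \<and> \<eta> \<in> C}"
    using finite_kdist_values[OF assms(1)] assms(2,3) by (intro Max_ge) auto
  then show ?thesis using assms(2) by (auto simp: kdiam_def)
qed

lemma kdiam_ball:
  assumes "\<theta>0 \<in> Theta n"
  shows "kdiam n {\<theta> \<in> Theta n. kdist n \<theta> \<theta>0 \<le> k} \<le> 2 * k"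
proof (rule kdiam_le)
  fix \<theta> \<eta>
  assume "\<theta> \<in> {\<theta> \<in> Theta n. kdist n \<theta> \<theta>0 \<le> k}" "\<eta> \<in> {\<theta> \<in> Theta n. kdist n \<theta> \<theta>0 \<le> k}"
  then show "kdist n \<theta> \<eta> \<le> 2 * k"
    using kdist_triangle[of \<theta> n \<theta>0 \<eta>] kdist_sym[of \<theta>0 n \<eta>] assms by auto
qed auto

lemma kdiam_enlarge:
  assumes C: "C \<subseteq> Theta n"
  shows "kdiam n (enlarge n k C) \<le> kdiam n C + 2 * k"
proof (rule kdiam_le)
  fix \<theta> \<theta>'
  assume "\<theta> \<in> enlarge n k C" "\<theta>' \<in> enlarge n k C"
  then obtain \<eta> \<eta>' where T: "\<theta> \<in> Theta n" "\<theta>' \<in> Theta n"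
    and h: "\<eta> \<in> C" "kdist n \<eta> \<theta> \<le> k" "\<eta>' \<in> C" "kdist n \<eta>' \<theta>' \<le> k"
    by (auto simp: enlarge_def)
  have T': "\<eta> \<in> Theta n" "\<eta>' \<in> Theta n" using h C by auto
  have "kdist n \<theta> \<theta>' \<le> kdist n \<theta> \<eta> + (kdist n \<eta> \<eta>' + kdist n \<eta>' \<theta>')"
    using kdist_triangle[OF T(1) T'(1) T(2)] kdist_triangle[OF T' T(2)] by linarith
  then show "kdist n \<theta> \<theta>' \<le> kdiam n C + 2 * k"
    using h kdist_le_kdiam[OF C h(1,3)] kdist_sym[OF T(1) T'(1)] by linarith
qed (auto simp: enlarge_def)

section \<open>Posterior masses\<close>

lemma set_pmf_prior_predictive:
  "set_pmf (prior_predictive n p q) = (\<Union>\<theta>\<in>Theta n. set_pmf (graph_law n p q \<theta>))"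
  unfolding prior_predictive_def
  by (simp add: set_bind_pmf set_pmf_of_set[OF Theta_nonempty finite_Theta])

lemma evidence_pos:
  assumes "x \<in> set_pmf (prior_predictive n p q)"
  shows "0 < (\<Sum>\<theta>\<in>Theta n. pmf (graph_law n p q \<theta>) x)"
proof -
  obtain \<theta> where "\<theta> \<in> Theta n" "x \<in> set_pmf (graph_law n p q \<theta>)"
    using assms by (auto simp: set_pmf_prior_predictive)
  then show ?thesis
    by (intro sum_pos2[OF finite_Theta, of \<theta>]) (auto simp: pmf_positive)
qed

lemma posterior_Theta:
  assumes "x \<in> set_pmf (prior_predictive n p q)"
  shows "posterior n p q (Theta n) x = 1"
  using evidence_pos[OF assms] by (simp add: posterior_def)

lemma posterior_disjoint_le_1:
  assumes "x \<in> set_pmf (prior_predictive n p q)"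
    and "A \<subseteq> Theta n" "B \<subseteq> Theta n" "A \<inter> B = {}"
  shows "posterior n p q A x + posterior n p q B x \<le> 1"
proof -
  let ?S = "\<lambda>A. \<Sum>\<theta>\<in>A. pmf (graph_law n p q \<theta>) x"
  have fin: "finite A" "finite B" using assms(2,3) finite_Theta finite_subset by blast+
  have "?S A + ?S B = ?S (A \<union> B)"
    by (rule sum.union_disjoint[symmetric, OF fin assms(4)])
  also have "\<dots> \<le> ?S (Theta n)"
    using assms(2,3) by (intro sum_mono2 finite_Theta) auto
  finally show ?thesis
    using evidence_pos[OF assms(1)]
    by (simp add: posterior_def add_divide_distrib[symmetric])
qed

section \<open>Credible sets against a posterior concentrated on a ball\<close>

lemma credible_enlarge_covers:
  assumes D: "credible n p q c D"
    and \<theta>0: "\<theta>0 \<in> Theta n"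
    and x: "x \<in> set_pmf (graph_law n p q \<theta>0)"
    and mass: "1 - c < posterior n p q {\<theta> \<in> Theta n. kdist n \<theta> \<theta>0 \<le> k} x"
  shows "\<theta>0 \<in> enlarge n k (D x)"
proof -
  let ?B = "{\<theta> \<in> Theta n. kdist n \<theta> \<theta>0 \<le> k}"
  have x': "x \<in> set_pmf (prior_predictive n p q)"
    using x \<theta>0 by (auto simp: set_pmf_prior_predictive)
  have "D x \<subseteq> Theta n"
    using D x set_pmf_graph_law by (fastforce simp: credible_def)
  moreover have "c \<le> posterior n p q (D x) x"
    using D x' by (auto simp: credible_def AE_measure_pmf_iff)
  ultimately have "D x \<inter> ?B \<noteq> {}"
    using posterior_disjoint_le_1[OF x', of "D x" ?B] mass by auto
  then show ?thesis using \<theta>0 by (auto simp: enlarge_def)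
qed

lemma minimal_diameter_le_ball:
  assumes min: "minimal_diameter n p q c D"
    and c: "c \<le> 1"
    and \<theta>0: "\<theta>0 \<in> Theta n"
    and x: "x \<in> set_pmf (graph_law n p q \<theta>0)"
    and mass: "c \<le> posterior n p q {\<theta> \<in> Theta n. kdist n \<theta> \<theta>0 \<le> k} x"
  shows "kdiam n (D x) \<le> 2 * k"
proof -
  let ?B = "{\<theta> \<in> Theta n. kdist n \<theta> \<theta>0 \<le> k}"
  \<comment> \<open>The ball alone need not be credible, as its mass may fall below \<open>c\<close> on other graphs.\<close>
  define E where "E x = (if c \<le> posterior n p q ?B x then ?B else Theta n)" for x
  have x': "x \<in> set_pmf (prior_predictive n p q)"
    using x \<theta>0 by (auto simp: set_pmf_prior_predictive)
  have "credible n p q c E"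
    using c by (auto simp: credible_def E_def AE_measure_pmf_iff posterior_Theta)
  then have "kdiam n (D x) \<le> kdiam n (E x)"
    using min x' by (auto simp: minimal_diameter_def AE_measure_pmf_iff)
  also have "E x = ?B" using mass by (simp add: E_def)
  also have "kdiam n ?B \<le> 2 * k" by (rule kdiam_ball[OF \<theta>0])
  finally show ?thesis .
qed

section \<open>Asymptotics\<close>

text \<open>The inclusion of events is asked for on the support of \<open>P n\<close> only, because credibility and
  minimality of diameters constrain only graphs of positive probability.\<close>

lemma tends_in_prob_eventually:
  assumes Y: "tends_in_prob P Y l" and \<epsilon>: "\<epsilon> > 0"
    and A: "eventually (\<lambda>n. \<forall>x\<in>set_pmf (P n). \<bar>Y n x - l\<bar> \<le> \<epsilon> \<longrightarrow> x \<in> A n) sequentially"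
  shows "(\<lambda>n. measure_pmf.prob (P n) (A n)) \<longlonglongrightarrow> 1"
proof (rule tendsto_sandwich)
  let ?bad = "\<lambda>n. {x. \<bar>Y n x - l\<bar> > \<epsilon>}"
  show "eventually (\<lambda>n. 1 - measure_pmf.prob (P n) (?bad n) \<le> measure_pmf.prob (P n) (A n))
          sequentially"
    using A
  proof eventually_elim
    case (elim n)
    have "1 - measure_pmf.prob (P n) (?bad n) = measure_pmf.prob (P n) (- ?bad n)"
      using measure_pmf.prob_compl[of "?bad n" "P n"] by (simp add: Compl_eq_Diff_UNIV)
    also have "\<dots> \<le> measure_pmf.prob (P n) (A n)"
      using elim by (intro measure_pmf.finite_measure_mono_AE) (auto simp: AE_measure_pmf_iff)
    finally show ?case .
  qed
  show "(\<lambda>n. 1 - measure_pmf.prob (P n) (?bad n)) \<longlonglongrightarrow> 1"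
    using tendsto_diff[OF tendsto_const, of "\<lambda>n. measure_pmf.prob (P n) (?bad n)" 0 _ 1] Y \<epsilon>
    by (simp add: tends_in_prob_def)
qed auto

lemma liminf_pos_eventually_gt:
  fixes c :: "nat \<Rightarrow> real"
  assumes "liminf (\<lambda>n. ereal (c n)) > 0"
  obtains \<epsilon> where "\<epsilon> > 0" "eventually (\<lambda>n. \<epsilon> < c n) sequentially"
proof -
  obtain e where e: "0 < ereal e" "ereal e < liminf (\<lambda>n. ereal (c n))"
    using ereal_dense2[OF assms] by blast
  from less_LiminfD[OF e(2)] e(1) that show thesis by auto
qed

lemma limsup_less_1_eventually_le:
  fixes c :: "nat \<Rightarrow> real"
  assumes "limsup (\<lambda>n. ereal (c n)) < 1"
  obtains \<epsilon> where "\<epsilon> > 0" "eventually (\<lambda>n. c n \<le> 1 - \<epsilon>) sequentially"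
proof -
  obtain e where e: "limsup (\<lambda>n. ereal (c n)) < ereal e" "ereal e < 1"
    using ereal_dense2[OF assms] by blast
  have "eventually (\<lambda>n. c n < e) sequentially"
    using Limsup_lessD[OF e(1)] by simp
  then have "eventually (\<lambda>n. c n \<le> 1 - (1 - e)) sequentially"
    by eventually_elim simp
  then show thesis using e(2) that[of "1 - e"] by simp
qed

theorem theorem4p2:
  fixes p q c :: "nat \<Rightarrow> real"
    and \<theta>0 :: "nat \<Rightarrow> (nat \<Rightarrow> nat) set"
    and k :: "nat \<Rightarrow> nat"
    and D :: "nat \<Rightarrow> nat set set \<Rightarrow> (nat \<Rightarrow> nat) set set"
  assumes p: "\<And>n. n \<ge> 1 \<Longrightarrow> 0 < p n \<and> p n < 1"
    and q: "\<And>n. n \<ge> 1 \<Longrightarrow> 0 < q n \<and> q n < 1"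
    and \<theta>0: "\<And>n. n \<ge> 1 \<Longrightarrow> \<theta>0 n \<in> Theta n"
    and k_pos: "\<And>n. n \<ge> 1 \<Longrightarrow> k n \<ge> 1"
    and k_small: "(\<lambda>n. real (k n)) \<in> o(\<lambda>n. real n)"
    and recovery: "tends_in_prob (\<lambda>n. graph_law n (p n) (q n) (\<theta>0 n))
      (\<lambda>n x. posterior n (p n) (q n) {\<theta> \<in> Theta n. kdist n \<theta> (\<theta>0 n) \<le> k n} x) 1"
    and c: "\<And>n. n \<ge> 1 \<Longrightarrow> 0 \<le> c n \<and> c n \<le> 1"
    and c_liminf: "liminf (\<lambda>n. ereal (c n)) > 0"
    and D: "\<And>n. n \<ge> 1 \<Longrightarrow> credible n (p n) (q n) (c n) (D n)"
  shows "((\<lambda>n. measure_pmf.prob (graph_law n (p n) (q n) (\<theta>0 n))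
            {x. \<theta>0 n \<in> enlarge n (k n) (D n x)}) \<longlonglongrightarrow> 1) \<and>
         (limsup (\<lambda>n. ereal (c n)) < 1 \<longrightarrow>
          (\<forall>n\<ge>1. minimal_diameter n (p n) (q n) (c n) (D n)) \<longrightarrow>
          ((\<lambda>n. measure_pmf.prob (graph_law n (p n) (q n) (\<theta>0 n))
             {x. kdiam n (D n x) \<le> 2 * k n \<and>
                 kdiam n (enlarge n (k n) (D n x)) \<le> 4 * k n}) \<longlonglongrightarrow> 1))"
proof (intro conjI impI)
  let ?P = "\<lambda>n. graph_law n (p n) (q n) (\<theta>0 n)"
  let ?Y = "\<lambda>n x. posterior n (p n) (q n) {\<theta> \<in> Theta n. kdist n \<theta> (\<theta>0 n) \<le> k n} x"
  obtain \<epsilon> where \<epsilon>: "\<epsilon> > 0" "eventually (\<lambda>n. \<epsilon> < c n) sequentially"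
    using liminf_pos_eventually_gt[OF c_liminf] .
  have "eventually (\<lambda>n. \<forall>x\<in>set_pmf (?P n). \<bar>?Y n x - 1\<bar> \<le> \<epsilon> \<longrightarrow>
          x \<in> {x. \<theta>0 n \<in> enlarge n (k n) (D n x)}) sequentially"
    using \<epsilon>(2) eventually_ge_at_top[of 1]
  proof eventually_elim
    case (elim n)
    show ?case
    proof (intro ballI impI CollectI)
      fix x assume x: "x \<in> set_pmf (?P n)" and Y: "\<bar>?Y n x - 1\<bar> \<le> \<epsilon>"
      from Y elim(1) have "1 - c n < ?Y n x" by linarith
      then show "\<theta>0 n \<in> enlarge n (k n) (D n x)"
        by (rule credible_enlarge_covers[OF D[OF elim(2)] \<theta>0[OF elim(2)] x])
    qed
  qed
  then show "(\<lambda>n. measure_pmf.prob (?P n) {x. \<theta>0 n \<in> enlarge n (k n) (D n x)}) \<longlonglongrightarrow> 1"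
    by (rule tends_in_prob_eventually[OF recovery \<epsilon>(1)])
next
  let ?P = "\<lambda>n. graph_law n (p n) (q n) (\<theta>0 n)"
  let ?Y = "\<lambda>n x. posterior n (p n) (q n) {\<theta> \<in> Theta n. kdist n \<theta> (\<theta>0 n) \<le> k n} x"
  assume limsup: "limsup (\<lambda>n. ereal (c n)) < 1"
    and min: "\<forall>n\<ge>1. minimal_diameter n (p n) (q n) (c n) (D n)"
  obtain \<epsilon> where \<epsilon>: "\<epsilon> > 0" "eventually (\<lambda>n. c n \<le> 1 - \<epsilon>) sequentially"
    using limsup_less_1_eventually_le[OF limsup] .
  have "eventually (\<lambda>n. \<forall>x\<in>set_pmf (?P n). \<bar>?Y n x - 1\<bar> \<le> \<epsilon> \<longrightarrow>
          x \<in> {x. kdiam n (D n x) \<le> 2 * k n \<and>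
                  kdiam n (enlarge n (k n) (D n x)) \<le> 4 * k n}) sequentially"
    using \<epsilon>(2) eventually_ge_at_top[of 1]
  proof eventually_elim
    case (elim n)
    show ?case
    proof (intro ballI impI CollectI)
      fix x assume x: "x \<in> set_pmf (?P n)" and Y: "\<bar>?Y n x - 1\<bar> \<le> \<epsilon>"
      from Y elim(1) have "c n \<le> ?Y n x" by linarith
      then have diam: "kdiam n (D n x) \<le> 2 * k n"
        using minimal_diameter_le_ball[OF _ _ \<theta>0[OF elim(2)] x] min c elim(2) by blast
      have "D n x \<subseteq> Theta n"
        using D[OF elim(2)] x set_pmf_graph_law by (fastforce simp: credible_def)
      then show "kdiam n (D n x) \<le> 2 * k n \<and> kdiam n (enlarge n (k n) (D n x)) \<le> 4 * k n"
        using diam kdiam_enlarge[of "D n x" n "k n"] by simp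
    qed
  qed
  then show "(\<lambda>n. measure_pmf.prob (?P n) {x. kdiam n (D n x) \<le> 2 * k n \<and>
               kdiam n (enlarge n (k n) (D n x)) \<le> 4 * k n}) \<longlonglongrightarrow> 1"
    by (rule tends_in_prob_eventually[OF recovery \<epsilon>(1)])
qed

end
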